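(* Let $\frac{1}{2}<\alpha<1$. Then \[ \max\left\{1,\ \frac{\alpha}{(2\alpha-1)^{1/2}}\,\frac{(2\alpha-1)^{\alpha-1/2}}{(2\alpha)^{\alpha}}\right\}\leq \liminf_{n\to\infty}\|\sigma_n^\alpha\| \] and \[ \limsup_{n\to\infty}\|\sigma_n^\alpha\|\leq \frac{\alpha}{(2\alpha-1)^{1/2}}. \]
   Context: $\Gamma$ is the Gamma function. Generalized binomial coefficients are defined by $\binom{x}{y}:=\frac{\Gamma(x+1)}{\Gamma(y+1)\Gamma(x-y+1)}$ for real $x\ge y>-1$. For an integer $n>1$ and $\alpha\in[0,1]$, put $c_k=c_{k,n}^\alpha=\binom{n+\alpha}{\alpha}^{-1}\binom{n-k+\alpha}{\alpha}$ for $k=0,\ldots,n$ and $c_k=0$ for $k>n$. The generalized Cesàro operator $\sigma_n^\alpha$ acts on a power series $f(z)=\sum_{k\ge0}a_kz^k$ by $(\sigma_n^\alpha f)(z)=\sum_{k=0}^n c_k a_k z^k$. For a sequence $c=(c_k)_{k\ge1}$ of complex numbers, $T_c$ denotes the infinite upper triangular matrix with entries $(T_c)_{ii}=c_i$, $(T_c)_{ij}=c_j-c_{j-1}$ for $j>i\geq 1$, and $(T_c)_{ij}=0$ for $j<i$. The norm is defined by $\|\sigma_n^\alpha\|:=\|T_c\|_{\ell^2\to\ell^2}$, the operator norm on $\ell^2=\ell^2(\{1,2,\ldots\})$ of $T_c$ for the sequence $c=(c_{k,n}^\alpha)_{k\ge1}$ with $c_{k,n}^\alpha=\binom{n+\alpha}{\alpha}^{-1}\binom{n-k+\alpha}{\alpha}$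 for $1\le k\le n$ and $c_{k,n}^\alpha=0$ for $k>n$. Equivalently (known fact), $\|\sigma_n^\alpha\|^2=\sup_f \mathcal{D}_1(\sigma_n^\alpha f)/\mathcal{D}_1(f)$, the supremum being over nonconstant $f$ holomorphic on the open unit disc $\mathbb{D}$ with $\mathcal{D}_1(f):=\int_{\mathbb{D}}\frac{1-|z|^2}{|1-z|^2}|f'(z)|^2\,dA(z)<\infty$, where $dA$ is area measure (its normalization does not affect the quotient). *)

theory Defs
  imports "HOL-Analysis.Analysis"
begin

text \<open>Meaningful for real \<open>x \<ge> y > -1\<close>.\<close>

definition gbinom :: "real \<Rightarrow> real \<Rightarrow> real" where
  "gbinom x y = Gamma (x + 1) / (Gamma (y + 1) * Gamma (x - y + 1))"

definition cesaro_coeff :: "nat \<Rightarrow> real \<Rightarrow> nat \<Rightarrow> real" where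
  "cesaro_coeff n \<alpha> k =
     (if k \<le> n then inverse (gbinom (real n + \<alpha>) \<alpha>) * gbinom (real n - real k + \<alpha>) \<alpha> else 0)"

text \<open>
  Vectors and matrices are indexed by the positive integers. They are represented by functions
  on \<^typ>\<open>nat\<close> whose values at index \<open>0\<close> are never used.
\<close>

definition ell2 :: "(nat \<Rightarrow> complex) set" where
  "ell2 = {x. (\<lambda>i. (norm (x i))\<^sup>2) summable_on {1..}}"

definition ell2_norm :: "(nat \<Rightarrow> complex) \<Rightarrow> real" where
  "ell2_norm x = sqrt (\<Sum>\<^sub>\<infinity>i\<in>{1..}. (norm (x i))\<^sup>2)"

definition mat_apply :: "(nat \<Rightarrow> nat \<Rightarrow> complex) \<Rightarrow> (nat \<Rightarrow> complex) \<Rightarrow> nat \<Rightarrow> complex" where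
  "mat_apply A x i = (\<Sum>\<^sub>\<infinity>j\<in>{1..}. A i j * x j)"

text \<open>
  The convergence of the row series and the membership of the image in \<^const>\<open>ell2\<close> are part
  of the condition, because the sums above have the value \<open>0\<close> when they diverge. The norm
  is \<open>\<infinity>\<close> exactly when the matrix does not define a bounded operator on \<^const>\<open>ell2\<close>.
\<close>

definition mat_bounded_by :: "(nat \<Rightarrow> nat \<Rightarrow> complex) \<Rightarrow> real \<Rightarrow> bool" where
  "mat_bounded_by A C \<longleftrightarrow>
     (\<forall>x\<in>ell2. (\<forall>i\<ge>1. (\<lambda>j. A i j * x j) summable_on {1..}) \<and>
        mat_apply A x \<in> ell2 \<and> ell2_norm (mat_apply A x) \<le> C * ell2_norm x)"

definition mat_opnorm :: "(nat \<Rightarrow> nat \<Rightarrow> complex) \<Rightarrow> ereal" where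
  "mat_opnorm A = (INF C\<in>{C. 0 \<le> C \<and> mat_bounded_by A C}. ereal C)"

definition T_mat :: "(nat \<Rightarrow> complex) \<Rightarrow> nat \<Rightarrow> nat \<Rightarrow> complex" where
  "T_mat c i j = (if j = i then c i else if i < j then c j - c (j - 1) else 0)"

definition cesaro_norm :: "nat \<Rightarrow> real \<Rightarrow> ereal" where
  "cesaro_norm n \<alpha> = mat_opnorm (T_mat (\<lambda>k. complex_of_real (cesaro_coeff n \<alpha> k)))"

end

theory Submission imports Defs begin

text \<open>
  With $\rho_j = L - c_j c_{j-1}$ and $L = \alpha^2/(2\alpha-1)$, summation by parts turns the bound
  $\|T^* y\|^2 \le L \|y\|^2$ into a weighted Hardy inequality
  $\sum_k b_k Y_k^2 \le \sum_j \rho_j y_j^2$ for the partial sums $Y_k$ of $y$, where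
  $b_k = c_k (2 c_k - c_{k+1} - c_{k-1}) \ge 0$. By Cauchy--Schwarz it suffices that
  $\sum_i \rho_i^{-1} \sum_{k \ge i} b_k \le 1$. This sum is at most
  $\frac{\ln r}{r-1}$ with $r = \alpha/(1-\alpha)$, so the upper bound holds for every $n$ and not
  only in the limit.

  For the lower bounds, test $T$ on the first unit vector, and on its first row truncated to the
  columns $j > n/(2\alpha)$, which is the cut-off that maximizes the limit.
\<close>

section \<open>Transposition, summation by parts and a weighted Hardy inequality\<close>

text \<open>A matrix and its transpose have the same norm: pairing \<open>t v\<close> with itself
  moves \<open>t\<close> to the other side, Cauchy-Schwarz bounds the square of \<open>N\<close> by
  a multiple of \<open>N\<close>, and one factor \<open>N\<close> cancels. This lets the upper bound
  be proved for the adjoint, where partial sums appear.\<close>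

lemma sum_square_matrix_dual:
  fixes t :: "'i \<Rightarrow> 'j \<Rightarrow> real"
  assumes "L \<ge> 0" and "\<And>y. (\<Sum>j\<in>J. (\<Sum>i\<in>I. t i j * y i)\<^sup>2) \<le> L * (\<Sum>i\<in>I. (y i)\<^sup>2)"
  shows "(\<Sum>i\<in>I. (\<Sum>j\<in>J. t i j * v j)\<^sup>2) \<le> L * (\<Sum>j\<in>J. (v j)\<^sup>2)"
proof -
  define y where "y i = (\<Sum>j\<in>J. t i j * v j)" for i
  define N where "N = (\<Sum>i\<in>I. (y i)\<^sup>2)"
  have N0: "N \<ge> 0" by (simp add: N_def sum_nonneg)
  have "N = (\<Sum>i\<in>I. \<Sum>j\<in>J. y i * (t i j * v j))"
    unfolding N_def power2_eq_square by (simp add: y_def sum_distrib_left)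
  also have "\<dots> = (\<Sum>j\<in>J. v j * (\<Sum>i\<in>I. t i j * y i))"
    by (subst sum.swap) (simp add: sum_distrib_left mult_ac)
  finally have "N\<^sup>2 \<le> (\<Sum>j\<in>J. (v j)\<^sup>2) * (\<Sum>j\<in>J. (\<Sum>i\<in>I. t i j * y i)\<^sup>2)"
    using Cauchy_Schwarz_ineq_sum[of v "\<lambda>j. \<Sum>i\<in>I. t i j * y i" J] by simp
  also have "\<dots> \<le> (\<Sum>j\<in>J. (v j)\<^sup>2) * (L * N)"
    unfolding N_def by (intro mult_left_mono assms sum_nonneg) auto
  finally have le: "N * N \<le> (L * (\<Sum>j\<in>J. (v j)\<^sup>2)) * N"
    by (simp add: power2_eq_square mult_ac)
  show ?thesis
  proof (cases "N = 0")
    case True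
    with \<open>L \<ge> 0\<close> show ?thesis unfolding N_def y_def by (simp add: sum_nonneg)
  next
    case False
    with N0 have "N > 0" by simp
    with le show ?thesis unfolding N_def[symmetric] y_def[symmetric] by simp
  qed
qed

text \<open>The summand on the left is the square of
  \<open>c j * Y j - c (j - 1) * Y (j - 1)\<close>, the \<open>j\<close>-th entry of the adjoint
  applied to \<open>y\<close>. Its cross term is removed by writing
  \<open>2 * Y j * Y (j - 1)\<close> as the sum of the squares of \<open>Y j\<close> and
  \<open>Y (j - 1)\<close> minus the square of \<open>y j\<close>; collecting the squares of each
  \<open>Y k\<close> produces the second difference.\<close>

lemma T_adjoint_norm_square:
  fixes c y :: "nat \<Rightarrow> real"
  assumes "c (Suc n) = 0"
  defines "Y \<equiv> \<lambda>k. \<Sum>i=1..k. y i"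
  shows "(\<Sum>j=1..Suc n. (c j * y j + (c j - c (j - 1)) * Y (j - 1))\<^sup>2) =
           (\<Sum>j=1..n. c j * c (j - 1) * (y j)\<^sup>2)
         + (\<Sum>k=1..n. c k * (2 * c k - c (Suc k) - c (k - 1)) * (Y k)\<^sup>2)"
proof -
  \<comment> \<open>The subtracted term is the part of the coefficient of the square of
    \<open>Y m\<close> that only column \<open>Suc m\<close> supplies.\<close>
  have "(\<Sum>j=1..m. (c j * y j + (c j - c (j - 1)) * Y (j - 1))\<^sup>2) =
           (\<Sum>j=1..m. c j * c (j - 1) * (y j)\<^sup>2)
         + (\<Sum>k=1..m. c k * (2 * c k - c (Suc k) - c (k - 1)) * (Y k)\<^sup>2)
         - c m * (c m - c (Suc m)) * (Y m)\<^sup>2" for m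
  proof (induction m)
    case 0
    show ?case by (simp add: Y_def)
  next
    case (Suc m)
    have "Y (Suc m) = Y m + y (Suc m)" by (simp add: Y_def)
    with Suc show ?case by (simp add: algebra_simps power2_eq_square)
  qed
  \<comment> \<open>Since \<open>c (Suc n) = 0\<close>, column \<open>Suc n\<close> contributes the
    square of \<open>c n * Y n\<close>, which cancels the boundary term.\<close>
  from this[of n] assms(1) show ?thesis by (simp add: power2_eq_square algebra_simps)
qed

text \<open>This is the bound of an operator norm by the Hilbert-Schmidt norm: Cauchy-Schwarz with
  weights \<open>\<rho>\<close> on each partial sum, followed by an exchange of the order of
  summation, which gives the tails of \<open>b\<close>.\<close>

lemma weighted_partial_sum_inequality:
  fixes b \<rho> y :: "nat \<Rightarrow> real"
  assumes b: "\<And>k. k \<in> {1..n} \<Longrightarrow> b k \<ge> 0" and \<rho>: "\<And>k. k \<in> {1..n} \<Longrightarrow> \<rho> k > 0"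
  shows "(\<Sum>k=1..n. b k * (\<Sum>i=1..k. y i)\<^sup>2)
           \<le> (\<Sum>i=1..n. (\<Sum>k=i..n. b k) / \<rho> i) * (\<Sum>i=1..n. \<rho> i * (y i)\<^sup>2)"
proof -
  define M where "M = (\<Sum>i=1..n. \<rho> i * (y i)\<^sup>2)"
  have "(\<Sum>i=1..k. y i)\<^sup>2 \<le> (\<Sum>i=1..k. 1 / \<rho> i) * M" if k: "k \<in> {1..n}" for k
  proof -
    have pos: "\<rho> i > 0" if "i \<in> {1..k}" for i using that k \<rho> by auto
    have "(\<Sum>i=1..k. y i) = (\<Sum>i=1..k. (1 / sqrt (\<rho> i)) * (sqrt (\<rho> i) * y i))"
      by (intro sum.cong) (use pos in force)+
    also have "\<dots>\<^sup>2 \<le> (\<Sum>i=1..k. (1 / sqrt (\<rho> i))\<^sup>2) * (\<Sum>i=1..k. (sqrt (\<rho> i) * y i)\<^sup>2)"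
      by (rule Cauchy_Schwarz_ineq_sum)
    also have "(\<Sum>i=1..k. (1 / sqrt (\<rho> i))\<^sup>2) = (\<Sum>i=1..k. 1 / \<rho> i)"
      by (intro sum.cong) (use pos in \<open>auto simp: power_divide less_imp_le\<close>)
    also have "(\<Sum>i=1..k. (sqrt (\<rho> i) * y i)\<^sup>2) = (\<Sum>i=1..k. \<rho> i * (y i)\<^sup>2)"
      by (intro sum.cong) (use pos in \<open>auto simp: power_mult_distrib less_imp_le\<close>)
    also have "(\<Sum>i=1..k. 1 / \<rho> i) * (\<Sum>i=1..k. \<rho> i * (y i)\<^sup>2) \<le> (\<Sum>i=1..k. 1 / \<rho> i) * M"
      unfolding M_def using k pos \<rho>
      by (intro mult_left_mono sum_mono2 sum_nonneg) (auto simp: less_imp_le)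
    finally show ?thesis .
  qed
  hence "(\<Sum>k=1..n. b k * (\<Sum>i=1..k. y i)\<^sup>2) \<le> (\<Sum>k=1..n. b k * ((\<Sum>i=1..k. 1 / \<rho> i) * M))"
    using b by (intro sum_mono mult_left_mono) auto
  also have "\<dots> = (\<Sum>k=1..n. \<Sum>i=1..k. b k / \<rho> i) * M"
    by (simp add: sum_distrib_left sum_distrib_right mult_ac)
  also have "(\<Sum>k=1..n. \<Sum>i=1..k. b k / \<rho> i) = (\<Sum>i=1..n. \<Sum>k=i..n. b k / \<rho> i)"
  proof -
    have "{i \<in> {1..n}. i \<le> k} = {1..k}" if "k \<in> {1..n}" for k using that by auto
    moreover have "{k \<in> {1..n}. i \<le> k} = {i..n}" if "i \<in> {1..n}" for i using that by auto
    ultimately show ?thesis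
      using sum.swap_restrict[of "{1..n}" "{1..n}" "\<lambda>k i. b k / \<rho> i" "\<lambda>k i. i \<le> k"] by simp
  qed
  finally show ?thesis unfolding M_def by (simp add: sum_divide_distrib)
qed

text \<open>The logarithmic mean of two positive numbers is at most their arithmetic mean. The
  derivative in \<open>p\<close> of the difference of the two sides is a square over a positive
  quantity.\<close>

lemma two_diff_div_sum_le_ln_diff:
  fixes p q :: real
  assumes "0 < q" "q \<le> p"
  shows "2 * (p - q) / (p + q) \<le> ln p - ln q"
proof -
  define f where "f x = ln x - ln q - 2 * (x - q) / (x + q)" for x
  have "f q \<le> f p"
  proof (rule DERIV_nonneg_imp_nondecreasing[OF assms(2)])
    fix x assume "q \<le> x" "x \<le> p"
    with assms have x: "x > 0" "x + q > 0" by auto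
    have "(f has_real_derivative (1 / x - 0 - (2 * (x + q) - 2 * (x - q)) / ((x + q) * (x + q)))) (at x)"
      unfolding f_def using x by (auto intro!: derivative_eq_intros)
    moreover have "1 / x - 0 - (2 * (x + q) - 2 * (x - q)) / ((x + q) * (x + q)) = 1 / x - 4 * q / (x + q)\<^sup>2"
      by (simp add: power2_eq_square)
    moreover have "1 / x - 4 * q / (x + q)\<^sup>2 = (x - q)\<^sup>2 / (x * (x + q)\<^sup>2)"
      using x by (simp add: divide_simps) (simp add: algebra_simps power2_eq_square)
    ultimately show "\<exists>y. (f has_real_derivative y) (at x) \<and> 0 \<le> y"
      using x by auto
  qed
  thus ?thesis by (simp add: f_def)
qed

section \<open>Recurrence, positivity and monotonicity of the coefficients\<close>

lemma cesaro_coeff_eq: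
  assumes "k \<le> n"
  shows "cesaro_coeff n \<alpha> k =
    inverse (gbinom (real n + \<alpha>) \<alpha>) * gbinom (real (n - k) + \<alpha>) \<alpha>"
  using assms by (simp add: cesaro_coeff_def of_nat_diff)

lemma gbinom_pos: "\<alpha> > 0 \<Longrightarrow> gbinom (real m + \<alpha>) \<alpha> > 0"
  by (auto simp: gbinom_def intro!: divide_pos_pos mult_pos_pos Gamma_real_pos)

lemma gbinom_Suc:
  assumes "\<alpha> > 0"
  shows "gbinom (real (Suc m) + \<alpha>) \<alpha> * real (Suc m) = gbinom (real m + \<alpha>) \<alpha> * (real (Suc m) + \<alpha>)"
proof -
  have g1: "Gamma ((real m + \<alpha> + 1) + 1) = (real m + \<alpha> + 1) * Gamma (real m + \<alpha> + 1)"
    by (rule Gamma_plus1) (use assms in \<open>auto elim!: nonpos_Ints_cases\<close>)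
  have g2: "Gamma ((real m + 1) + 1) = (real m + 1) * Gamma (real m + 1)"
    by (rule Gamma_plus1) (auto elim!: nonpos_Ints_cases)
  have "Gamma (\<alpha> + 1) > 0" "Gamma (real m + 1) > 0" "Gamma (real m + \<alpha> + 1) > 0"
    using assms by (auto intro!: Gamma_real_pos)
  thus ?thesis using g1 g2 assms
    by (simp add: gbinom_def add_ac divide_simps)
qed

lemma cesaro_coeff_0: "\<alpha> > 0 \<Longrightarrow> cesaro_coeff n \<alpha> 0 = 1"
  using gbinom_pos[of \<alpha> n] by (simp add: cesaro_coeff_eq)

lemma cesaro_coeff_beyond: "k > n \<Longrightarrow> cesaro_coeff n \<alpha> k = 0"
  by (simp add: cesaro_coeff_def)

lemma cesaro_coeff_nonneg: "\<alpha> > 0 \<Longrightarrow> cesaro_coeff n \<alpha> k \<ge> 0"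
  using gbinom_pos[of \<alpha> n] gbinom_pos[of \<alpha> "n - k"] cesaro_coeff_beyond[of n k \<alpha>]
  by (cases "k \<le> n") (auto simp: cesaro_coeff_eq)

text \<open>Follows from the recurrence of the binomials. The factor vanishes at
  \<open>k = n\<close>, so the formula also covers the step to the first zero coefficient.\<close>

lemma cesaro_coeff_Suc:
  assumes "\<alpha> > 0" "k \<le> n"
  shows "cesaro_coeff n \<alpha> (Suc k) = cesaro_coeff n \<alpha> k * (real (n - k) / (real (n - k) + \<alpha>))"
proof (cases "k = n")
  case True
  thus ?thesis by (simp add: cesaro_coeff_beyond)
next
  case False
  define m where "m = n - Suc k"
  from False assms have k: "Suc k \<le> n" "n - k = Suc m" by (auto simp: m_def)
  have "gbinom (real m + \<alpha>) \<alpha> =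
      gbinom (real (Suc m) + \<alpha>) \<alpha> * (real (Suc m) / (real (Suc m) + \<alpha>))"
    using gbinom_Suc[OF assms(1), of m] assms(1) by (simp add: field_simps)
  with k assms show ?thesis
    by (simp only: cesaro_coeff_eq m_def[symmetric] mult.assoc)
qed

lemma cesaro_coeff_pred:
  assumes "\<alpha> > 0" "k \<in> {1..n}"
  shows "cesaro_coeff n \<alpha> (k - 1) =
           cesaro_coeff n \<alpha> k * ((real (n - k) + 1 + \<alpha>) / (real (n - k) + 1))"
proof -
  have "n - (k - 1) = Suc (n - k)" "Suc (k - 1) = k" using assms by auto
  with cesaro_coeff_Suc[of \<alpha> "k - 1" n] assms show ?thesis
    by (simp add: field_simps)
qed

lemma cesaro_coeff_antimono:
  assumes "\<alpha> > 0"
  shows "cesaro_coeff n \<alpha> (Suc k) \<le> cesaro_coeff n \<alpha> k"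
proof (cases "k \<le> n")
  case True
  have "real (n - k) / (real (n - k) + \<alpha>) \<le> 1" using assms by simp
  with True show ?thesis
    using cesaro_coeff_nonneg[OF assms, of n k] mult_left_mono[of _ 1 "cesaro_coeff n \<alpha> k"]
    by (simp only: cesaro_coeff_Suc[OF assms]) fastforce
next
  case False
  thus ?thesis by (simp add: cesaro_coeff_beyond)
qed

lemma cesaro_coeff_le_1:
  assumes "\<alpha> > 0"
  shows "cesaro_coeff n \<alpha> k \<le> 1"
proof (induction k)
  case 0
  show ?case using cesaro_coeff_0[OF assms] by simp
next
  case (Suc k)
  show ?case using cesaro_coeff_antimono[OF assms, of n k] Suc by (rule order_trans)
qed

section \<open>Second differences and the bound for the adjoint\<close>

text \<open>Both neighbours are rational multiples of \<open>c k\<close>, and the bracket divided by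
  \<open>c k\<close> is \<open>\<alpha> / (m + \<alpha>) - \<alpha> / (m + 1)\<close>. For \<alpha>
  < 1 this is positive, so the coefficients are concave up to the index \<open>n\<close>.\<close>

lemma cesaro_coeff_second_difference:
  assumes "\<alpha> > 0" "k \<in> {1..n}"
  defines "c \<equiv> cesaro_coeff n \<alpha>" and "m \<equiv> real (n - k)"
  shows "c k * (2 * c k - c (Suc k) - c (k - 1)) = (c k)\<^sup>2 * (\<alpha> * (1 - \<alpha>) / ((m + \<alpha>) * (m + 1)))"
proof -
  have m: "m \<ge> 0" by (simp add: m_def)
  have c: "c (Suc k) = c k * (m / (m + \<alpha>))" "c (k - 1) = c k * ((m + 1 + \<alpha>) / (m + 1))"
    unfolding c_def m_def using cesaro_coeff_Suc cesaro_coeff_pred assms by auto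
  show ?thesis unfolding c using m assms(1)
    by (simp add: divide_simps add_nonneg_eq_0_iff) (simp add: algebra_simps power2_eq_square)
qed

text \<open>The tail is bounded by an increment of the squares of \<open>c\<close>, because such an
  increment, divided by a suitable denominator, can later be compared with an increment of a
  logarithm and summed by telescoping.\<close>

lemma cesaro_coeff_second_difference_tail:
  assumes \<alpha>: "1/2 < \<alpha>" "\<alpha> < 1" and i: "i \<in> {1..n}"
  defines "c \<equiv> cesaro_coeff n \<alpha>"
  shows "(\<Sum>k=i..n. c k * (2 * c k - c (Suc k) - c (k - 1)))
           \<le> (1 - \<alpha>) / (2 * (2 * \<alpha> - 1)) * ((c (i - 1))\<^sup>2 - (c i)\<^sup>2)"
proof -
  define K where "K = \<alpha> * (1 - \<alpha>) / (2 * \<alpha> - 1)"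
  \<comment> \<open>Since the summand behaves like a multiple of \<open>\<alpha> (1 - \<alpha>) m^(2\<alpha>-2)\<close> with \<open>m = n - k\<close>, its tail sums behave like the same multiple of
    \<open>K m^(2\<alpha>-1)\<close>; \<open>H\<close> has this growth and majorizes them exactly.\<close>
  define H where "H k = K * (c k)\<^sup>2 / (real (n - k) + 1)" for k
  have K: "K > 0" using \<alpha> by (simp add: K_def)
  have step: "c k * (2 * c k - c (Suc k) - c (k - 1)) \<le> H k - H (Suc k)" if k: "k \<in> {1..n}" for k
  proof -
    define m where "m = real (n - k)"
    have m: "m \<ge> 0" by (simp add: m_def)
    have cS: "c (Suc k) = c k * (m / (m + \<alpha>))"
      unfolding c_def m_def using cesaro_coeff_Suc k \<alpha> by auto
    have HS: "H (Suc k) = (c k)\<^sup>2 * (K * (m / (m + \<alpha>)\<^sup>2))"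
    \<comment> \<open>Truncated subtraction breaks the index shift at \<open>k = n\<close>; there
      both sides are zero.\<close>
    proof (cases "k = n")
      case True
      thus ?thesis using cS by (simp add: H_def m_def)
    next
      case False
      hence "real (n - Suc k) + 1 = m" "m > 0" using k by (auto simp: m_def)
      thus ?thesis unfolding H_def cS by (simp add: power2_eq_square)
    qed
    \<comment> \<open>The value of \<open>K\<close> is the one for which the terms linear in
      \<open>m\<close> cancel in the numerator.\<close>
    have "K * (1 / (m + 1) - m / (m + \<alpha>)\<^sup>2) - \<alpha> * (1 - \<alpha>) / ((m + \<alpha>) * (m + 1))
            = (\<alpha> * (1 - \<alpha>))\<^sup>2 / ((2 * \<alpha> - 1) * (m + 1) * (m + \<alpha>)\<^sup>2)"
      using \<alpha> m unfolding K_def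
      by (simp add: divide_simps add_nonneg_eq_0_iff) (simp add: algebra_simps power2_eq_square)
    also have "\<dots> \<ge> 0" using \<alpha> m by simp
    finally have "\<alpha> * (1 - \<alpha>) / ((m + \<alpha>) * (m + 1)) \<le> K * (1 / (m + 1) - m / (m + \<alpha>)\<^sup>2)" by simp
    hence "(c k)\<^sup>2 * (\<alpha> * (1 - \<alpha>) / ((m + \<alpha>) * (m + 1))) \<le> (c k)\<^sup>2 * (K * (1 / (m + 1) - m / (m + \<alpha>)\<^sup>2))"
      by (intro mult_left_mono) auto
    also have "\<dots> = H k - H (Suc k)"
      unfolding HS by (simp add: H_def m_def algebra_simps)
    finally show ?thesis
      using cesaro_coeff_second_difference[of \<alpha> k n] k \<alpha> by (simp add: c_def m_def)
  qed
  have "(\<Sum>k=i..n. c k * (2 * c k - c (Suc k) - c (k - 1))) \<le> (\<Sum>k=i..n. H k - H (Suc k))"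
    by (intro sum_mono step) (use i in auto)
  also have "\<dots> = H i - H (Suc n)"
    using sum_Suc_diff[of i n "\<lambda>k. - H k"] i by simp
  also have "\<dots> = H i" by (simp add: H_def c_def cesaro_coeff_beyond)
  also have "\<dots> \<le> (1 - \<alpha>) / (2 * (2 * \<alpha> - 1)) * ((c (i - 1))\<^sup>2 - (c i)\<^sup>2)"
  proof -
    define m where "m = real (n - i)"
    have m: "m \<ge> 0" by (simp add: m_def)
    have cp: "c (i - 1) = c i * ((m + 1 + \<alpha>) / (m + 1))"
      unfolding c_def m_def using cesaro_coeff_pred i \<alpha> by auto
    \<comment> \<open>The leading part of the increment reproduces \<open>H i\<close> exactly; only
      the contribution of \<alpha> squared remains.\<close>
    have "(1 - \<alpha>) / (2 * (2 * \<alpha> - 1)) * ((c (i - 1))\<^sup>2 - (c i)\<^sup>2) - H i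
            = (c i)\<^sup>2 * (\<alpha>\<^sup>2 * (1 - \<alpha>) / (2 * (2 * \<alpha> - 1) * (m + 1)\<^sup>2))"
      using \<alpha> m unfolding cp H_def K_def m_def[symmetric]
      by (simp add: divide_simps) (simp add: algebra_simps power2_eq_square)
    also have "\<dots> \<ge> 0" using \<alpha> m by simp
    finally show ?thesis by simp
  qed
  finally show ?thesis .
qed

text \<open>After summation by parts, all that is needed is that the Hilbert-Schmidt constant for
  the weights \<open>b\<close> and \<open>\<rho>\<close> is at most 1.\<close>

lemma cesaro_adjoint_bound:
  fixes n :: nat and y :: "nat \<Rightarrow> real"
  assumes \<alpha>: "1/2 < \<alpha>" "\<alpha> < 1"
  defines "c \<equiv> cesaro_coeff n \<alpha>"
  shows "(\<Sum>j=1..Suc n. (c j * y j + (c j - c (j - 1)) * (\<Sum>i=1..j-1. y i))\<^sup>2)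
           \<le> \<alpha>\<^sup>2 / (2 * \<alpha> - 1) * (\<Sum>i=1..n. (y i)\<^sup>2)"
proof -
  define L where "L = \<alpha>\<^sup>2 / (2 * \<alpha> - 1)"
  define K where "K = (1 - \<alpha>) / (2 * (2 * \<alpha> - 1))"
  define b where "b k = c k * (2 * c k - c (Suc k) - c (k - 1))" for k
  define \<rho> where "\<rho> k = L - c k * c (k - 1)" for k
  have pos: "\<alpha> > 0" using \<alpha> by simp
  \<comment> \<open>Used twice: \<open>L > 1\<close> makes every \<open>\<rho> k\<close> positive,
    and the formula later evaluates \<open>L / (L - 1)\<close>.\<close>
  have L1: "L - 1 = (1 - \<alpha>)\<^sup>2 / (2 * \<alpha> - 1)"
    using \<alpha> by (simp add: L_def field_simps power2_eq_square)
  also have "\<dots> > 0" using \<alpha> by simp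
  finally have "L > 1" by simp
  have "K > 0" using \<alpha> by (simp add: K_def)
  have c01: "0 \<le> c k" "c k \<le> 1" for k
    using cesaro_coeff_nonneg cesaro_coeff_le_1 pos by (auto simp: c_def)
  have less: "c k * c l < L" for k l
    using mult_mono[of "c k" 1 "c l" 1] c01[of k] c01[of l] \<open>L > 1\<close> by simp
  have less2: "(c k)\<^sup>2 < L" for k using less[of k k] by (simp add: power2_eq_square)
  have \<rho>: "\<rho> k > 0" for k using less by (simp add: \<rho>_def)
  have b: "b k \<ge> 0" if "k \<in> {1..n}" for k
    using cesaro_coeff_second_difference[OF pos that] \<alpha> by (simp add: b_def c_def)
  have "(\<Sum>i=1..n. (\<Sum>k=i..n. b k) / \<rho> i) \<le> (\<Sum>i=1..n. K * (ln (L - (c i)\<^sup>2) - ln (L - (c (i - 1))\<^sup>2)))"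
  proof (rule sum_mono)
    fix i assume i: "i \<in> {1..n}"
    have ci: "c i \<le> c (i - 1)" using cesaro_coeff_antimono[OF pos, of n "i - 1"] i by (simp add: c_def)
    have D: "0 \<le> (c (i - 1))\<^sup>2 - (c i)\<^sup>2" using ci c01 by (simp add: power_mono)
    have q: "L - (c (i - 1))\<^sup>2 > 0" using less2 by simp
    \<comment> \<open>The arithmetic-geometric inequality for \<open>c i\<close> and
      \<open>c (i - 1)\<close>. It replaces the mixed product in \<open>\<rho> i\<close> by squares,
      so that the denominator fits the logarithmic mean inequality.\<close>
    have s: "(L - (c i)\<^sup>2) + (L - (c (i - 1))\<^sup>2) \<le> 2 * \<rho> i"
      using zero_le_power2[of "c (i - 1) - c i"] by (simp add: \<rho>_def power2_diff algebra_simps)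
    have s0: "(L - (c i)\<^sup>2) + (L - (c (i - 1))\<^sup>2) > 0" using less2[of i] q by simp
    have "(\<Sum>k=i..n. b k) / \<rho> i \<le> K * ((c (i - 1))\<^sup>2 - (c i)\<^sup>2) / \<rho> i"
      using cesaro_coeff_second_difference_tail[OF \<alpha> i] \<rho>[of i]
      by (intro divide_right_mono) (auto simp: b_def c_def K_def)
    also have "\<dots> = K * (2 * ((c (i - 1))\<^sup>2 - (c i)\<^sup>2) / (2 * \<rho> i))"
      by (subst mult_divide_mult_cancel_left) auto
    also have "\<dots> \<le> K * (2 * ((c (i - 1))\<^sup>2 - (c i)\<^sup>2) / ((L - (c i)\<^sup>2) + (L - (c (i - 1))\<^sup>2)))"
      using \<open>K > 0\<close> D s s0 \<rho>[of i] by (intro mult_left_mono divide_left_mono mult_pos_pos) auto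
    also have "\<dots> \<le> K * (ln (L - (c i)\<^sup>2) - ln (L - (c (i - 1))\<^sup>2))"
      using two_diff_div_sum_le_ln_diff[OF q, of "L - (c i)\<^sup>2"] D \<open>K > 0\<close>
      by (intro mult_left_mono) auto
    finally show "(\<Sum>k=i..n. b k) / \<rho> i \<le> \<dots>" .
  qed
  \<comment> \<open>The logarithms telescope, and \<open>c 0 = 1\<close> supplies
    \<open>L - 1\<close>.\<close>
  also have "\<dots> = K * (ln (L - (c n)\<^sup>2) - ln (L - 1))"
  proof -
    have "(\<Sum>i=1..n. ln (L - (c i)\<^sup>2) - ln (L - (c (i - 1))\<^sup>2)) = ln (L - (c n)\<^sup>2) - ln (L - (c 0)\<^sup>2)"
      by (induction n) auto
    thus ?thesis using cesaro_coeff_0[OF pos] by (simp add: sum_distrib_left[symmetric] c_def)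
  qed
  also have "\<dots> \<le> K * (ln L - ln (L - 1))"
    using \<open>K > 0\<close> \<open>L > 1\<close> less2[of n] by (intro mult_left_mono) auto
  also have "ln L - ln (L - 1) = ln ((\<alpha> / (1 - \<alpha>))\<^sup>2)"
  proof -
    have "L / (L - 1) = (\<alpha> / (1 - \<alpha>))\<^sup>2"
      unfolding L1 using \<alpha> by (simp add: L_def power_divide)
    with \<open>L > 1\<close> show ?thesis using ln_div[of L "L - 1"] by simp
  qed
  also have "\<dots> = 2 * ln (\<alpha> / (1 - \<alpha>))"
    using \<alpha> by (simp add: ln_realpow)
  \<comment> \<open>Here \<open>2 * K\<close> is the reciprocal of
    \<open>\<alpha> / (1 - \<alpha>) - 1\<close>, so the tangent line bound for \<open>ln\<close>
    gives exactly 1.\<close>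
  also have "K * \<dots> \<le> K * (2 * (\<alpha> / (1 - \<alpha>) - 1))"
    using \<open>K > 0\<close> \<alpha> by (intro mult_left_mono ln_le_minus_one) auto
  also have "\<dots> = 1" using \<alpha> by (simp add: K_def divide_simps)
  finally have trace: "(\<Sum>i=1..n. (\<Sum>k=i..n. b k) / \<rho> i) \<le> 1" .
  have "(\<Sum>k=1..n. b k * (\<Sum>i=1..k. y i)\<^sup>2)
          \<le> (\<Sum>i=1..n. (\<Sum>k=i..n. b k) / \<rho> i) * (\<Sum>i=1..n. \<rho> i * (y i)\<^sup>2)"
    by (rule weighted_partial_sum_inequality) (use b \<rho> in auto)
  also have "\<dots> \<le> 1 * (\<Sum>i=1..n. \<rho> i * (y i)\<^sup>2)"
    using \<rho> by (intro mult_right_mono trace sum_nonneg) (auto simp: less_imp_le)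
  finally have "(\<Sum>k=1..n. b k * (\<Sum>i=1..k. y i)\<^sup>2) \<le> (\<Sum>i=1..n. \<rho> i * (y i)\<^sup>2)" by simp
  moreover have "(\<Sum>i=1..n. \<rho> i * (y i)\<^sup>2) = L * (\<Sum>i=1..n. (y i)\<^sup>2) - (\<Sum>j=1..n. c j * c (j - 1) * (y j)\<^sup>2)"
    by (simp add: \<rho>_def algebra_simps sum_subtractf sum_distrib_left)
  ultimately show ?thesis
    using T_adjoint_norm_square[of c n y] by (simp add: L_def b_def c_def cesaro_coeff_beyond)
qed

section \<open>A lower bound for the squared differences\<close>

text \<open>Each squared difference up to \<open>j = n\<close> dominates a decrement of a multiple
  of \<open>(c k)\<^sup>2 / (real (n - k) + \<alpha>)\<close>. Telescoping down to
  \<open>k = n\<close> leaves the term with \<open>c n\<close>; the nonnegative term at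
  \<open>j = Suc n\<close> is dropped.\<close>

lemma cesaro_coeff_difference_square_tail:
  assumes \<alpha>: "1/2 < \<alpha>" "\<alpha> < 1" and "k \<le> n"
  defines "c \<equiv> cesaro_coeff n \<alpha>"
  shows "(\<Sum>j=Suc k..Suc n. (c j - c (j - 1))\<^sup>2)
           \<ge> \<alpha>\<^sup>2 / (2 * \<alpha> - 1) * ((c k)\<^sup>2 / (real (n - k) + \<alpha>) - (c n)\<^sup>2 / \<alpha>)"
  using \<open>k \<le> n\<close>
proof (induction k rule: inc_induct)
  case base
  show ?case by (simp add: sum_nonneg)
next
  case (step k)
  define m where "m = real (n - k)"
  define L where "L = \<alpha>\<^sup>2 / (2 * \<alpha> - 1)"
  have m: "m \<ge> 1" "real (n - Suc k) = m - 1" using step by (auto simp: m_def)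
  have cS: "c (Suc k) = c k * (m / (m + \<alpha>))"
    unfolding c_def m_def using cesaro_coeff_Suc step \<alpha> by auto
  have "(c k)\<^sup>2 * (\<alpha> / (m + \<alpha>))\<^sup>2 + L * ((c (Suc k))\<^sup>2 / (m - 1 + \<alpha>)) - L * ((c k)\<^sup>2 / (m + \<alpha>))
          = (c k)\<^sup>2 * (\<alpha>\<^sup>2 * (1 - \<alpha>)\<^sup>2 / ((2 * \<alpha> - 1) * (m + \<alpha>)\<^sup>2 * (m - 1 + \<alpha>)))"
    using \<alpha> m unfolding cS L_def
    by (simp add: divide_simps add_nonneg_eq_0_iff) (simp add: algebra_simps power2_eq_square)
  also have "\<dots> \<ge> 0" using \<alpha> m by simp
  finally have "L * ((c k)\<^sup>2 / (m + \<alpha>)) \<le> (c k)\<^sup>2 * (\<alpha> / (m + \<alpha>))\<^sup>2 + L * ((c (Suc k))\<^sup>2 / (m - 1 + \<alpha>))" by simp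
  moreover have "c (Suc k) - c k = - (c k * (\<alpha> / (m + \<alpha>)))"
    unfolding cS using m \<alpha> by (simp add: field_simps)
  hence "(c (Suc k) - c k)\<^sup>2 = (c k)\<^sup>2 * (\<alpha> / (m + \<alpha>))\<^sup>2"
    by (simp only: power2_minus power_mult_distrib)
  moreover have "(\<Sum>j=Suc k..Suc n. (c j - c (j - 1))\<^sup>2)
      = (c (Suc k) - c k)\<^sup>2 + (\<Sum>j=Suc (Suc k)..Suc n. (c j - c (j - 1))\<^sup>2)"
    using step by (subst sum.atLeast_Suc_atMost) auto
  ultimately show ?case using step.IH m
    unfolding L_def[symmetric] m_def[symmetric] by (simp add: algebra_simps)
qed

section \<open>Matrices on the sequence space and their finite sections\<close>

lemma infsum_finite_range:
  fixes f :: "nat \<Rightarrow> 'a :: {comm_monoid_add, t2_space}"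
  assumes "\<And>j. j > N \<Longrightarrow> f j = 0"
  shows "f summable_on {1..}" "infsum f {1..} = sum f {1..N}"
proof -
  have "f summable_on {1..} \<longleftrightarrow> f summable_on {1..N}"
    by (rule summable_on_cong_neutral) (use assms in auto)
  thus "f summable_on {1..}" by simp
  have "infsum f {1..} = infsum f {1..N}"
    by (rule infsum_cong_neutral) (use assms in auto)
  thus "infsum f {1..} = sum f {1..N}" by simp
qed

text \<open>A real matrix acts separately on real and imaginary parts, so a real bound for the
  finite block carries over to complex vectors with the same constant.\<close>

lemma mat_bounded_by_of_real:
  fixes t :: "nat \<Rightarrow> nat \<Rightarrow> real"
  assumes col: "\<And>i j. j > N \<Longrightarrow> t i j = 0" and row: "\<And>i j. i > M \<Longrightarrow> t i j = 0"
    and "L \<ge> 0"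
    and bound: "\<And>v. (\<Sum>i=1..M. (\<Sum>j=1..N. t i j * v j)\<^sup>2) \<le> L * (\<Sum>j=1..N. (v j)\<^sup>2)"
  shows "mat_bounded_by (\<lambda>i j. complex_of_real (t i j)) (sqrt L)"
  unfolding mat_bounded_by_def
proof (intro ballI conjI allI impI)
  fix x assume x: "x \<in> ell2"
  let ?A = "\<lambda>i j. complex_of_real (t i j)"
  show "(\<lambda>j. ?A i j * x j) summable_on {1..}" for i
    by (rule infsum_finite_range[of N]) (simp add: col)
  have app: "mat_apply ?A x i = (\<Sum>j=1..N. ?A i j * x j)" for i
    unfolding mat_apply_def by (rule infsum_finite_range) (simp add: col)
  have zero: "(norm (mat_apply ?A x i))\<^sup>2 = 0" if "i > M" for i
    using that by (simp add: app row)
  show "mat_apply ?A x \<in> ell2"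
    unfolding ell2_def mem_Collect_eq by (rule infsum_finite_range[of M]) (rule zero)
  have "(\<Sum>\<^sub>\<infinity>i\<in>{1..}. (norm (mat_apply ?A x i))\<^sup>2) = (\<Sum>i=1..M. (norm (mat_apply ?A x i))\<^sup>2)"
    by (rule infsum_finite_range) (rule zero)
  also have "\<dots> = (\<Sum>i=1..M. (\<Sum>j=1..N. t i j * Re (x j))\<^sup>2) + (\<Sum>i=1..M. (\<Sum>j=1..N. t i j * Im (x j))\<^sup>2)"
    by (simp add: cmod_power2 app Re_sum Im_sum sum.distrib)
  also have "\<dots> \<le> L * (\<Sum>j=1..N. (Re (x j))\<^sup>2) + L * (\<Sum>j=1..N. (Im (x j))\<^sup>2)"
    by (intro add_mono bound)
  also have "\<dots> = L * (\<Sum>j=1..N. (norm (x j))\<^sup>2)"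
    by (simp add: cmod_power2 sum.distrib algebra_simps)
  also have "\<dots> \<le> L * (\<Sum>\<^sub>\<infinity>j\<in>{1..}. (norm (x j))\<^sup>2)"
    using x \<open>L \<ge> 0\<close> unfolding ell2_def
    by (intro mult_left_mono finite_sum_le_infsum) auto
  finally show "ell2_norm (mat_apply ?A x) \<le> sqrt L * ell2_norm x"
    unfolding ell2_norm_def real_sqrt_mult[symmetric] by simp
qed

text \<open>Obtained by applying the full matrix to the vector truncated after \<open>N\<close> and
  discarding the rows beyond \<open>M\<close>; it turns finite test vectors into lower bounds for
  the norm.\<close>

lemma mat_bounded_by_section:
  assumes "mat_bounded_by A C"
  shows "(\<Sum>i=1..M. (norm (\<Sum>j=1..N. A i j * x j))\<^sup>2) \<le> C\<^sup>2 * (\<Sum>j=1..N. (norm (x j))\<^sup>2)"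
proof -
  define z where "z j = (if j \<le> N then x j else 0)" for j
  have sq: "(\<lambda>j. (norm (z j))\<^sup>2) summable_on {1..}"
      "(\<Sum>\<^sub>\<infinity>j\<in>{1..}. (norm (z j))\<^sup>2) = (\<Sum>j=1..N. (norm (z j))\<^sup>2)"
    by (rule infsum_finite_range[of N]; simp add: z_def)+
  have app: "mat_apply A z i = (\<Sum>j=1..N. A i j * x j)" for i
  proof -
    have "mat_apply A z i = (\<Sum>j=1..N. A i j * z j)"
      unfolding mat_apply_def by (rule infsum_finite_range) (simp add: z_def)
    thus ?thesis by (simp add: z_def)
  qed
  have "z \<in> ell2" using sq by (simp add: ell2_def)
  with assms have m: "mat_apply A z \<in> ell2" "ell2_norm (mat_apply A z) \<le> C * ell2_norm z"
    by (auto simp: mat_bounded_by_def)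
  have "(\<Sum>i=1..M. (norm (\<Sum>j=1..N. A i j * x j))\<^sup>2) \<le> (\<Sum>\<^sub>\<infinity>i\<in>{1..}. (norm (mat_apply A z i))\<^sup>2)"
    unfolding app[symmetric] using m(1) by (intro finite_sum_le_infsum) (auto simp: ell2_def)
  also have "\<dots> = (ell2_norm (mat_apply A z))\<^sup>2"
    by (simp add: ell2_norm_def infsum_nonneg)
  also have "\<dots> \<le> (C * ell2_norm z)\<^sup>2"
    using m(2) by (intro power_mono) (auto simp: ell2_norm_def infsum_nonneg)
  also have "\<dots> = C\<^sup>2 * (\<Sum>j=1..N. (norm (z j))\<^sup>2)"
    unfolding ell2_norm_def sq by (simp add: power_mult_distrib sum_nonneg)
  finally show ?thesis by (simp add: z_def)
qed

section \<open>Bounds for the norm at fixed \<open>n\<close>\<close>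

text \<open>The nonzero entries lie in \<open>n\<close> rows and \<open>Suc n\<close> columns: the
  last column still carries \<open>- c n\<close>. On this block the adjoint bound is
  dualized.\<close>

lemma cesaro_norm_le:
  assumes \<alpha>: "1/2 < \<alpha>" "\<alpha> < 1"
  shows "cesaro_norm n \<alpha> \<le> ereal (sqrt (\<alpha>\<^sup>2 / (2 * \<alpha> - 1)))"
proof -
  define c where "c = cesaro_coeff n \<alpha>"
  define t where "t i j = (if j = i then c i else if i < j then c j - c (j - 1) else 0)" for i j
  have L: "\<alpha>\<^sup>2 / (2 * \<alpha> - 1) \<ge> 0" using \<alpha> by simp
  have c0: "c k = 0" if "k > n" for k using that by (simp add: c_def cesaro_coeff_beyond)
  have col: "(\<Sum>i=1..n. t i j * y i) = c j * y j + (c j - c (j - 1)) * (\<Sum>i=1..j-1. y i)"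
    if j: "j \<in> {1..Suc n}" for j y
  proof -
    \<comment> \<open>Row \<open>Suc n\<close> vanishes; including it allows
      \<open>j = Suc n\<close> to be treated like the other columns.\<close>
    have "(\<Sum>i=1..n. t i j * y i) = (\<Sum>i=1..Suc n. t i j * y i)"
      by (simp add: t_def c0)
    also have "\<dots> = (\<Sum>i=1..j. t i j * y i)"
      using j by (intro sum.mono_neutral_right) (auto simp: t_def)
    also have "\<dots> = t j j * y j + (\<Sum>i=1..j-1. t i j * y i)"
      using j by (cases j) auto
    also have "(\<Sum>i=1..j-1. t i j * y i) = (\<Sum>i=1..j-1. (c j - c (j - 1)) * y i)"
      using j by (intro sum.cong) (auto simp: t_def)
    finally show ?thesis by (simp add: t_def sum_distrib_left)
  qed
  have "(\<Sum>i=1..n. (\<Sum>j=1..Suc n. t i j * v j)\<^sup>2) \<le> \<alpha>\<^sup>2 / (2 * \<alpha> - 1) * (\<Sum>j=1..Suc n. (v j)\<^sup>2)" for v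
  proof (rule sum_square_matrix_dual[OF L])
    fix y :: "nat \<Rightarrow> real"
    have "(\<Sum>j=1..Suc n. (\<Sum>i=1..n. t i j * y i)\<^sup>2)
        = (\<Sum>j=1..Suc n. (c j * y j + (c j - c (j - 1)) * (\<Sum>i=1..j-1. y i))\<^sup>2)"
      by (intro sum.cong refl arg_cong[where f = "\<lambda>u. u\<^sup>2"] col)
    also have "\<dots> \<le> \<alpha>\<^sup>2 / (2 * \<alpha> - 1) * (\<Sum>i=1..n. (y i)\<^sup>2)"
      unfolding c_def by (rule cesaro_adjoint_bound[OF \<alpha>])
    finally show "(\<Sum>j=1..Suc n. (\<Sum>i=1..n. t i j * y i)\<^sup>2) \<le> \<dots>" .
  qed
  hence "mat_bounded_by (\<lambda>i j. complex_of_real (t i j)) (sqrt (\<alpha>\<^sup>2 / (2 * \<alpha> - 1)))"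
    by (intro mat_bounded_by_of_real[of "Suc n" _ n] L) (auto simp: t_def c0)
  also have "(\<lambda>i j. complex_of_real (t i j)) = T_mat (\<lambda>k. complex_of_real (c k))"
    by (auto simp: fun_eq_iff t_def T_mat_def)
  finally show ?thesis
    unfolding cesaro_norm_def mat_opnorm_def c_def using L by (intro INF_lower) auto
qed

lemma cesaro_norm_geI:
  assumes "\<And>C. C \<ge> 0 \<Longrightarrow> mat_bounded_by (T_mat (\<lambda>k. complex_of_real (cesaro_coeff n \<alpha> k))) C \<Longrightarrow> r \<le> C"
  shows "ereal r \<le> cesaro_norm n \<alpha>"
  unfolding cesaro_norm_def mat_opnorm_def using assms by (intro INF_greatest) auto

lemma cesaro_norm_ge_coeff_1:
  assumes "\<alpha> > 0"
  shows "ereal (cesaro_coeff n \<alpha> 1) \<le> cesaro_norm n \<alpha>"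
proof (rule cesaro_norm_geI)
  fix C :: real
  assume "C \<ge> 0" "mat_bounded_by (T_mat (\<lambda>k. complex_of_real (cesaro_coeff n \<alpha> k))) C"
  with mat_bounded_by_section[OF this(2), where M = 1 and N = 1 and x = "\<lambda>_. 1"]
  show "cesaro_coeff n \<alpha> 1 \<le> C"
    using power2_le_imp_le[of "cesaro_coeff n \<alpha> 1" C] by (simp add: T_mat_def)
qed

text \<open>In the columns beyond \<open>k\<close> the first \<open>k\<close> rows coincide. Testing
  on this common row gives \<open>D\<close> in each of them, while the test vector has squared norm
  \<open>D\<close>, so the squared operator norm is at least \<open>real k * D\<close>.\<close>

lemma cesaro_norm_ge_tail:
  fixes \<alpha> :: real
  assumes "k \<le> n"
  defines "c \<equiv> cesaro_coeff n \<alpha>"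
  shows "ereal (sqrt (real k * (\<Sum>j=Suc k..Suc n. (c j - c (j - 1))\<^sup>2))) \<le> cesaro_norm n \<alpha>"
proof (rule cesaro_norm_geI)
  fix C :: real
  define d where "d j = c j - c (j - 1)" for j
  define D where "D = (\<Sum>j=Suc k..Suc n. (d j)\<^sup>2)"
  define x where "x j = (if k < j then complex_of_real (d j) else 0)" for j
  let ?A = "T_mat (\<lambda>k. complex_of_real (c k))"
  assume C: "C \<ge> 0" "mat_bounded_by (T_mat (\<lambda>k. complex_of_real (cesaro_coeff n \<alpha> k))) C"
  have D0: "D \<ge> 0" by (simp add: D_def sum_nonneg)
  have row: "(\<Sum>j=1..Suc n. ?A i j * x j) = complex_of_real D" if "i \<in> {1..k}" for i
  proof -
    have "(\<Sum>j=1..Suc n. ?A i j * x j) = (\<Sum>j=Suc k..Suc n. ?A i j * x j)"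
      by (rule sum.mono_neutral_right) (auto simp: x_def)
    also have "\<dots> = (\<Sum>j=Suc k..Suc n. complex_of_real ((d j)\<^sup>2))"
      using that by (intro sum.cong) (auto simp: x_def T_mat_def d_def power2_eq_square)
    finally show ?thesis by (simp add: D_def)
  qed
  have nx: "(\<Sum>j=1..Suc n. (norm (x j))\<^sup>2) = D"
  proof -
    have "(\<Sum>j=1..Suc n. (norm (x j))\<^sup>2) = (\<Sum>j=Suc k..Suc n. (norm (x j))\<^sup>2)"
      by (rule sum.mono_neutral_right) (auto simp: x_def)
    also have "\<dots> = D" unfolding D_def by (intro sum.cong) (auto simp: x_def)
    finally show ?thesis .
  qed
  have "real k * D\<^sup>2 = (\<Sum>i=1..k. (norm (\<Sum>j=1..Suc n. ?A i j * x j))\<^sup>2)"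
    by (simp only: row cong: sum.cong) simp
  also have "\<dots> \<le> C\<^sup>2 * D"
    using mat_bounded_by_section[OF C(2), where M = k and N = "Suc n" and x = x] unfolding nx c_def .
  finally have "(real k * D) * D \<le> C\<^sup>2 * D" by (simp add: power2_eq_square)
  hence "real k * D \<le> C\<^sup>2"
    using D0 by (cases "D = 0") auto
  hence "sqrt (real k * D) \<le> sqrt (C\<^sup>2)" by (rule real_sqrt_le_mono)
  thus "sqrt (real k * (\<Sum>j=Suc k..Suc n. (c j - c (j - 1))\<^sup>2)) \<le> C"
    using C(1) by (simp add: D_def d_def)
qed

section \<open>Asymptotics of the coefficients and the limit bounds\<close>

text \<open>Euler's limit formula for Gamma at \<open>\<alpha> + 1\<close>, after writing the
  binomial as a Pochhammer symbol over a factorial.\<close>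

lemma gbinom_asymptotics:
  assumes "\<alpha> > 0"
  shows "(\<lambda>n. real n powr \<alpha> / gbinom (real n + \<alpha>) \<alpha>) \<longlonglongrightarrow> Gamma (\<alpha> + 1)"
proof (rule Lim_transform_eventually[OF Gamma_series'_LIMSEQ])
  show "\<forall>\<^sub>F n in sequentially. Gamma_series' (\<alpha> + 1) n = real n powr \<alpha> / gbinom (real n + \<alpha>) \<alpha>"
    using eventually_gt_at_top[of 0]
  proof eventually_elim
    case (elim n)
    have "\<alpha> + 1 \<notin> \<int>\<^sub>\<le>\<^sub>0" using assms by (auto elim!: nonpos_Ints_cases)
    hence "gbinom (real n + \<alpha>) \<alpha> = pochhammer (\<alpha> + 1) n / fact n"
      using pochhammer_Gamma[of "\<alpha> + 1" n] Gamma_fact[of n, where 'a = real] assms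
      by (simp add: gbinom_def add_ac)
    moreover have "exp ((\<alpha> + 1) * ln (real n)) = real n * real n powr \<alpha>"
      using elim by (simp add: powr_def algebra_simps exp_add)
    moreover have "fact n = real n * fact (n - 1)" using elim by (simp add: fact_reduce)
    ultimately show ?case by (simp add: Gamma_series'_def)
  qed
qed

lemma tendsto_nat_floor_ratio:
  fixes r :: real
  assumes "r \<ge> 0"
  shows "(\<lambda>n. real (nat \<lfloor>r * real n\<rfloor>) / real n) \<longlonglongrightarrow> r"
proof (rule tendsto_sandwich)
  show "\<forall>\<^sub>F n in sequentially. r - 1 / real n \<le> real (nat \<lfloor>r * real n\<rfloor>) / real n"
    using eventually_gt_at_top[of 0]
  proof eventually_elim
    case (elim n)
    have "r * real n - 1 \<le> real (nat \<lfloor>r * real n\<rfloor>)" using assms by linarith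
    hence "(r * real n - 1) / real n \<le> real (nat \<lfloor>r * real n\<rfloor>) / real n"
      by (rule divide_right_mono) simp
    with elim show ?case by (simp add: diff_divide_distrib)
  qed
  show "\<forall>\<^sub>F n in sequentially. real (nat \<lfloor>r * real n\<rfloor>) / real n \<le> r"
    using eventually_gt_at_top[of 0]
  proof eventually_elim
    case (elim n)
    have "real (nat \<lfloor>r * real n\<rfloor>) \<le> r * real n" using assms by simp
    with elim show ?case by (simp add: field_simps)
  qed
  show "(\<lambda>n. r - 1 / real n) \<longlonglongrightarrow> r"
    using tendsto_diff[OF tendsto_const lim_1_over_n] by simp
qed auto

text \<open>As \<open>s > 0\<close> forces \<open>q n\<close> to infinity, the normalized binomials
  at \<open>n\<close> and \<open>q n\<close> have the same nonzero limit, and only the ratio of the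
  powers survives.\<close>

lemma gbinom_ratio_tendsto:
  fixes q :: "nat \<Rightarrow> nat"
  assumes "\<alpha> > 0" "s > 0" "(\<lambda>n. real (q n) / real n) \<longlonglongrightarrow> s"
  shows "(\<lambda>n. gbinom (real (q n) + \<alpha>) \<alpha> / gbinom (real n + \<alpha>) \<alpha>) \<longlonglongrightarrow> s powr \<alpha>"
proof -
  define u where "u n = real n powr \<alpha> / gbinom (real n + \<alpha>) \<alpha>" for n
  have u: "u \<longlonglongrightarrow> Gamma (\<alpha> + 1)" unfolding u_def by (rule gbinom_asymptotics[OF assms(1)])
  have G: "Gamma (\<alpha> + 1) \<noteq> 0" using assms(1) Gamma_real_pos[of "\<alpha> + 1"] by linarith
  have "filterlim (\<lambda>n. real (q n) / real n * real n) at_top sequentially"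
    by (rule filterlim_tendsto_pos_mult_at_top[OF assms(3,2) filterlim_real_sequentially])
  moreover have "\<forall>\<^sub>F n in sequentially. real (q n) / real n * real n = real (q n)"
    using eventually_gt_at_top[of 0] by eventually_elim simp
  ultimately have rq: "filterlim (\<lambda>n. real (q n)) at_top sequentially"
    by (simp add: filterlim_cong)
  hence q: "filterlim q at_top sequentially"
    by (simp add: filterlim_sequentially_iff_filterlim_real)
  have "(\<lambda>n. u n / u (q n) * (real (q n) / real n) powr \<alpha>)
          \<longlonglongrightarrow> Gamma (\<alpha> + 1) / Gamma (\<alpha> + 1) * s powr \<alpha>"
    using assms G by (intro tendsto_intros u filterlim_compose[OF u q]) auto
  moreover have "\<forall>\<^sub>F n in sequentially. u n / u (q n) * (real (q n) / real n) powr \<alpha>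
      = gbinom (real (q n) + \<alpha>) \<alpha> / gbinom (real n + \<alpha>) \<alpha>"
    using eventually_gt_at_top[of 0] filterlim_at_top_dense[THEN iffD1, OF rq, rule_format, of 0]
  proof eventually_elim
    case (elim n)
    thus ?case using gbinom_pos[OF assms(1), of n] gbinom_pos[OF assms(1), of "q n"]
      by (simp add: u_def powr_divide)
  qed
  ultimately show ?thesis using G by (simp add: Lim_transform_eventually)
qed

lemma cesaro_coeff_1_tendsto:
  assumes "\<alpha> > 0"
  shows "(\<lambda>n. cesaro_coeff n \<alpha> 1) \<longlonglongrightarrow> 1"
proof -
  have "(\<lambda>n. 1 / (1 + \<alpha> * (1 / real n))) \<longlonglongrightarrow> 1 / (1 + \<alpha> * 0)"
    by (intro tendsto_intros lim_1_over_n) auto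
  moreover have "\<forall>\<^sub>F n in sequentially. 1 / (1 + \<alpha> * (1 / real n)) = cesaro_coeff n \<alpha> 1"
    using eventually_gt_at_top[of 0]
  proof eventually_elim
    case (elim n)
    thus ?case using cesaro_coeff_Suc[OF assms, of 0 n] cesaro_coeff_0[OF assms, of n] assms
      by (simp add: field_simps)
  qed
  ultimately show ?thesis by (simp add: Lim_transform_eventually)
qed

text \<open>The last coefficient has order \<open>n\<close> to the power -\<alpha>, so the product
  has order \<open>n\<close> to the negative power 1 - 2\<alpha>. This removes the boundary term
  left by telescoping.\<close>

lemma cesaro_coeff_last_square_tendsto:
  assumes "\<alpha> > 1/2"
  shows "(\<lambda>n. real n * (cesaro_coeff n \<alpha> n)\<^sup>2) \<longlonglongrightarrow> 0"
proof -
  define u where "u n = real n powr \<alpha> / gbinom (real n + \<alpha>) \<alpha>" for n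
  have u: "u \<longlonglongrightarrow> Gamma (\<alpha> + 1)" unfolding u_def by (rule gbinom_asymptotics) (use assms in simp)
  have "(\<lambda>n. (u n)\<^sup>2 * real n powr (1 - 2 * \<alpha>)) \<longlonglongrightarrow> (Gamma (\<alpha> + 1))\<^sup>2 * 0"
    using assms by (intro tendsto_intros u tendsto_neg_powr filterlim_real_sequentially) auto
  moreover have "\<forall>\<^sub>F n in sequentially. (u n)\<^sup>2 * real n powr (1 - 2 * \<alpha>) = real n * (cesaro_coeff n \<alpha> n)\<^sup>2"
    using eventually_gt_at_top[of 0]
  proof eventually_elim
    case (elim n)
    have "Gamma (\<alpha> + 1) > 0" using assms by (intro Gamma_real_pos) simp
    hence "gbinom \<alpha> \<alpha> = 1" by (simp add: gbinom_def)
    hence c: "cesaro_coeff n \<alpha> n = inverse (gbinom (real n + \<alpha>) \<alpha>)"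
      by (simp add: cesaro_coeff_eq)
    have "(real n powr \<alpha>)\<^sup>2 * real n powr (1 - 2 * \<alpha>) = real n"
      using elim by (simp add: power2_eq_square powr_add[symmetric])
    thus ?case unfolding c u_def
      by (simp add: power_mult_distrib power_inverse divide_inverse)
  qed
  ultimately show ?thesis by (simp add: Lim_transform_eventually)
qed

theorem theorem3p3:
  fixes \<alpha> :: real
  assumes "1/2 < \<alpha>" and "\<alpha> < 1"
  shows "ereal (max 1 (\<alpha> / (2 * \<alpha> - 1) powr (1/2) *
             ((2 * \<alpha> - 1) powr (\<alpha> - 1/2) / (2 * \<alpha>) powr \<alpha>)))
           \<le> liminf (\<lambda>n. cesaro_norm n \<alpha>)
         \<and> limsup (\<lambda>n. cesaro_norm n \<alpha>) \<le> ereal (\<alpha> / (2 * \<alpha> - 1) powr (1/2))"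
proof
  define \<beta> where "\<beta> = 2 * \<alpha> - 1"
  define L where "L = \<alpha>\<^sup>2 / \<beta>"
  have \<beta>: "\<beta> > 0" and \<alpha>: "\<alpha> > 0" using assms by (auto simp: \<beta>_def)
  have sqrtL: "sqrt L = \<alpha> / \<beta> powr (1/2)"
    using \<alpha> \<beta> by (simp add: L_def real_sqrt_divide powr_half_sqrt)
  show "limsup (\<lambda>n. cesaro_norm n \<alpha>) \<le> ereal (\<alpha> / (2 * \<alpha> - 1) powr (1/2))"
    using cesaro_norm_le[OF assms] sqrtL by (intro Limsup_bounded) (auto simp: L_def \<beta>_def)

  \<comment> \<open>With \<open>k n\<close> asymptotic to \<open>r * n\<close> and
    \<open>s = 1 - r\<close>, the squared lower bound tends to \<open>L * r\<close> times
    \<open>s\<close> to the power 2\<alpha> - 1, which is largest at this \<open>r\<close>.\<close>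
  define r where "r = 1 / (2 * \<alpha>)"
  define s where "s = \<beta> / (2 * \<alpha>)"
  have rs: "r \<ge> 0" "r \<le> 1" "s > 0" "1 - r = s"
    using assms \<beta> by (auto simp: r_def s_def \<beta>_def field_simps)
  define k where "k n = nat \<lfloor>r * real n\<rfloor>" for n
  have kn: "k n \<le> n" for n
  proof -
    have "r * real n \<le> real n" using rs by (simp add: mult_left_le_one_le)
    thus ?thesis unfolding k_def by linarith
  qed
  have k: "(\<lambda>n. real (k n) / real n) \<longlonglongrightarrow> r"
    unfolding k_def by (rule tendsto_nat_floor_ratio[OF rs(1)])
  have "(\<lambda>n. 1 - real (k n) / real n) \<longlonglongrightarrow> s"
    unfolding rs(4)[symmetric] by (intro tendsto_intros k)
  moreover have "\<forall>\<^sub>F n in sequentially. 1 - real (k n) / real n = real (n - k n) / real n"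
    using eventually_gt_at_top[of 0] by eventually_elim (use kn in \<open>auto simp: of_nat_diff field_simps\<close>)
  ultimately have q: "(\<lambda>n. real (n - k n) / real n) \<longlonglongrightarrow> s"
    by (rule Lim_transform_eventually)
  have ck: "(\<lambda>n. cesaro_coeff n \<alpha> (k n)) \<longlonglongrightarrow> s powr \<alpha>"
    using gbinom_ratio_tendsto[OF \<alpha> rs(3) q] kn by (simp add: cesaro_coeff_eq divide_inverse mult.commute)

  \<comment> \<open>The lower bound for \<open>real k\<close> times the tail sum, rescaled by
    \<open>n\<close> so that every factor converges; the term with \<open>c n\<close> disappears in
    the limit.\<close>
  define g where "g n = L * ((cesaro_coeff n \<alpha> (k n))\<^sup>2
      * (real (k n) / real n / (real (n - k n) / real n + \<alpha> * (1 / real n)))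
      - real (k n) / real n * (real n * (cesaro_coeff n \<alpha> n)\<^sup>2) / \<alpha>)" for n
  have "g \<longlonglongrightarrow> L * ((s powr \<alpha>)\<^sup>2 * (r / (s + \<alpha> * 0)) - r * 0 / \<alpha>)"
    unfolding g_def using rs \<alpha>
    by (intro tendsto_intros ck k q lim_1_over_n cesaro_coeff_last_square_tendsto assms) auto
  hence g: "(\<lambda>n. sqrt (g n)) \<longlonglongrightarrow> sqrt (L * ((s powr \<alpha>)\<^sup>2 * (r / s)))"
    by (auto intro: tendsto_real_sqrt)
  \<comment> \<open>The quotient \<open>r / s\<close> is the reciprocal of
    \<open>\<beta>\<close>.\<close>
  have "sqrt (L * ((s powr \<alpha>)\<^sup>2 * (r / s))) = sqrt L * (s powr \<alpha> / sqrt \<beta>)"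
    using \<alpha> \<beta> by (simp add: real_sqrt_mult real_sqrt_divide r_def s_def)
  also have "s powr \<alpha> / sqrt \<beta> = \<beta> powr (\<alpha> - 1/2) / (2 * \<alpha>) powr \<alpha>"
    using \<alpha> \<beta> by (simp add: s_def powr_divide powr_diff powr_half_sqrt)
  finally have limit: "sqrt (L * ((s powr \<alpha>)\<^sup>2 * (r / s)))
      = \<alpha> / \<beta> powr (1/2) * (\<beta> powr (\<alpha> - 1/2) / (2 * \<alpha>) powr \<alpha>)"
    by (simp add: sqrtL)

  \<comment> \<open>Both test vectors are used at each \<open>n\<close>, so the maximum passes to
    the limit by continuity.\<close>
  have "\<forall>\<^sub>F n in sequentially. ereal (max (cesaro_coeff n \<alpha> 1) (sqrt (g n))) \<le> cesaro_norm n \<alpha>"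
    using eventually_gt_at_top[of 0]
  proof eventually_elim
    case (elim n)
    define D where "D = (\<Sum>j=Suc (k n)..Suc n. (cesaro_coeff n \<alpha> j - cesaro_coeff n \<alpha> (j - 1))\<^sup>2)"
    have "real (k n) / real n / (real (n - k n) / real n + \<alpha> * (1 / real n)) = real (k n) / (real (n - k n) + \<alpha>)"
      using elim \<alpha> by (simp add: divide_simps add_nonneg_eq_0_iff)
    hence "g n = real (k n) * (L * ((cesaro_coeff n \<alpha> (k n))\<^sup>2 / (real (n - k n) + \<alpha>) - (cesaro_coeff n \<alpha> n)\<^sup>2 / \<alpha>))"
      using elim by (simp add: g_def algebra_simps)
    also have "\<dots> \<le> real (k n) * D"
      using cesaro_coeff_difference_square_tail[OF assms kn]
      by (intro mult_left_mono) (auto simp: D_def L_def \<beta>_def)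
    finally have "ereal (sqrt (g n)) \<le> ereal (sqrt (real (k n) * D))" by simp
    also have "\<dots> \<le> cesaro_norm n \<alpha>"
      unfolding D_def by (rule cesaro_norm_ge_tail[OF kn])
    finally show ?case using cesaro_norm_ge_coeff_1[OF \<alpha>, of n] by (auto simp: max_def)
  qed
  hence "liminf (\<lambda>n. ereal (max (cesaro_coeff n \<alpha> 1) (sqrt (g n)))) \<le> liminf (\<lambda>n. cesaro_norm n \<alpha>)"
    by (rule Liminf_mono)
  moreover have "(\<lambda>n. ereal (max (cesaro_coeff n \<alpha> 1) (sqrt (g n))))
      \<longlonglongrightarrow> ereal (max 1 (sqrt (L * ((s powr \<alpha>)\<^sup>2 * (r / s)))))"
    by (intro tendsto_intros cesaro_coeff_1_tendsto \<alpha> g)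
  hence "liminf (\<lambda>n. ereal (max (cesaro_coeff n \<alpha> 1) (sqrt (g n))))
      = ereal (max 1 (sqrt (L * ((s powr \<alpha>)\<^sup>2 * (r / s)))))"
    by (intro lim_imp_Liminf) auto
  ultimately show "ereal (max 1 (\<alpha> / (2 * \<alpha> - 1) powr (1/2) *
             ((2 * \<alpha> - 1) powr (\<alpha> - 1/2) / (2 * \<alpha>) powr \<alpha>)))
           \<le> liminf (\<lambda>n. cesaro_norm n \<alpha>)"
    unfolding limit \<beta>_def by simp
qed

end
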